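(* Let $X$ be a Banach space over $\mathbb{R}$ or $\mathbb{C}$, let $1\leq p<\infty$ and $k\in\mathbb{N}$. The $p$-th joint numerical radius $w_p(\cdot)$ defines a norm on $L(X)^k$ if and only if the numerical radius $w(\cdot)$ defines a norm on $L(X)$.
   Context: $L(X)$ is the space of bounded linear operators on $X$. $S_X$ denotes the unit sphere of $X$, $X^*$ the dual space, and $\Pi_X=\{(x,x^* )\in S_X\times S_{X^*}: x^*(x)=1\}$. For $T\in L(X)$, the numerical radius is $w(T)=\sup\{|x^*(Tx)|:(x,x^* )\in\Pi_X\}$. For $\mathcal{T}=(T_1,\ldots,T_k)\in L(X)^k$, the $p$-th joint numerical radius is $w_p(\mathcal{T})=\sup\{(\sum_{i=1}^k|x^*(T_ix)|^p)^{1/p}:(x,x^* )\in\Pi_X\}$. *)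

theory Defs
  imports "HOL-Analysis.Analysis"
begin

text \<open>
  The library has no class of complex normed spaces. A normed space over a scalar field
  \<open>'k\<close> (below: real or complex) is a real normed space together with a
  multiplication \<open>smul\<close> by elements of \<open>'k\<close> that extends \<open>scaleR\<close>
  and for which the norm is homogeneous.
\<close>

locale normed_space_over = vector_space smul
  for smul :: "'k::real_normed_field \<Rightarrow> 'a::real_normed_vector \<Rightarrow> 'a" +
  assumes scale_of_real: "smul (of_real r) x = r *\<^sub>R x"
    and norm_scale: "norm (smul c x) = norm c * norm x"

lemma normed_space_over_scaleR:
  "normed_space_over (scaleR :: real \<Rightarrow> 'a::real_normed_vector \<Rightarrow> 'a)"
  by unfold_locales (auto simp: algebra_simps)

text \<open>
  Elements of \<open>'a \<Rightarrow>\<^sub>L 'b\<close> are bounded and real-linear; here linearity over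
  \<open>'k\<close> is required.
\<close>

definition bounded_operators ::
    "('k::real_normed_field \<Rightarrow> 'a::real_normed_vector \<Rightarrow> 'a) \<Rightarrow>
     ('k \<Rightarrow> 'b::real_normed_vector \<Rightarrow> 'b) \<Rightarrow> ('a \<Rightarrow>\<^sub>L 'b) set"
  where "bounded_operators s1 s2 = {T. Vector_Spaces.linear s1 s2 (blinfun_apply T)}"

abbreviation L_space ::
    "('k::real_normed_field \<Rightarrow> 'a::real_normed_vector \<Rightarrow> 'a) \<Rightarrow> ('a \<Rightarrow>\<^sub>L 'a) set"
  where "L_space smul \<equiv> bounded_operators smul smul"

abbreviation dual_space ::
    "('k::real_normed_field \<Rightarrow> 'a::real_normed_vector \<Rightarrow> 'a) \<Rightarrow> ('a \<Rightarrow>\<^sub>L 'k) set"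
  where "dual_space smul \<equiv> bounded_operators smul (*)"

definition scale_op ::
    "('k::real_normed_field \<Rightarrow> 'a::real_normed_vector \<Rightarrow> 'a) \<Rightarrow>
     'k \<Rightarrow> ('a \<Rightarrow>\<^sub>L 'a) \<Rightarrow> ('a \<Rightarrow>\<^sub>L 'a)"
  where "scale_op smul c T = Blinfun (\<lambda>x. smul c (blinfun_apply T x))"

lemma (in normed_space_over) bounded_linear_scale: "bounded_linear (smul c)"
proof (rule bounded_linear_intro[where K = "norm c"])
  fix r x
  show "smul c (r *\<^sub>R x) = r *\<^sub>R smul c x"
    by (metis scale_left_commute scale_of_real)
qed (simp_all add: scale_right_distrib norm_scale mult.commute)

lemma (in normed_space_over) scale_op_apply:
  "blinfun_apply (scale_op smul c T) x = smul c (blinfun_apply T x)"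
  unfolding scale_op_def
  by (subst bounded_linear_Blinfun_apply)
     (auto intro: bounded_linear_compose[OF bounded_linear_scale] blinfun.bounded_linear_right)

text \<open>
  \<open>L(X)^k\<close> with \<open>k = CARD('n)\<close>, so that \<open>k\<close> ranges over the positive integers.
\<close>

definition L_tuples ::
    "('k::real_normed_field \<Rightarrow> 'a::real_normed_vector \<Rightarrow> 'a) \<Rightarrow>
     (('a \<Rightarrow>\<^sub>L 'a) ^ 'n) set"
  where "L_tuples smul = {T. \<forall>i. T $ i \<in> L_space smul}"

definition scale_tuple ::
    "('k::real_normed_field \<Rightarrow> 'a::real_normed_vector \<Rightarrow> 'a) \<Rightarrow>
     'k \<Rightarrow> ('a \<Rightarrow>\<^sub>L 'a) ^ 'n \<Rightarrow> ('a \<Rightarrow>\<^sub>L 'a) ^ 'n"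
  where "scale_tuple smul c T = (\<chi> i. scale_op smul c (T $ i))"

definition Pi_set ::
    "('k::real_normed_field \<Rightarrow> 'a::real_normed_vector \<Rightarrow> 'a) \<Rightarrow> ('a \<times> ('a \<Rightarrow>\<^sub>L 'k)) set"
  where "Pi_set smul =
    {(x, f). norm x = 1 \<and> f \<in> dual_space smul \<and> norm f = 1 \<and> blinfun_apply f x = 1}"

text \<open>
  The suprema are taken over sets of nonnegative reals; over the empty set (which occurs
  only for the zero space) the value is 0, whereas \<open>Sup {}\<close> is unspecified in type real.
\<close>

definition nonneg_Sup :: "real set \<Rightarrow> real"
  where "nonneg_Sup A = (if A = {} then 0 else Sup A)"

definition numerical_radius ::
    "('k::real_normed_field \<Rightarrow> 'a::real_normed_vector \<Rightarrow> 'a) \<Rightarrow> ('a \<Rightarrow>\<^sub>L 'a) \<Rightarrow> real"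
  where "numerical_radius smul T =
    nonneg_Sup {norm (blinfun_apply f (blinfun_apply T x)) | x f. (x, f) \<in> Pi_set smul}"

definition joint_numerical_radius ::
    "('k::real_normed_field \<Rightarrow> 'a::real_normed_vector \<Rightarrow> 'a) \<Rightarrow>
     real \<Rightarrow> ('a \<Rightarrow>\<^sub>L 'a) ^ 'n \<Rightarrow> real"
  where "joint_numerical_radius smul p T =
    nonneg_Sup {(\<Sum>i\<in>UNIV. norm (blinfun_apply f (blinfun_apply (T $ i) x)) powr p) powr (1 / p)
      | x f. (x, f) \<in> Pi_set smul}"

definition is_norm_on ::
    "('k::real_normed_field \<Rightarrow> 'v::ab_group_add \<Rightarrow> 'v) \<Rightarrow> 'v set \<Rightarrow> ('v \<Rightarrow> real) \<Rightarrow> bool"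
  where "is_norm_on smul V N \<longleftrightarrow>
    (\<forall>u\<in>V. 0 \<le> N u) \<and>
    (\<forall>u\<in>V. N u = 0 \<longleftrightarrow> u = 0) \<and>
    (\<forall>c. \<forall>u\<in>V. N (smul c u) = norm c * N u) \<and>
    (\<forall>u\<in>V. \<forall>v\<in>V. N (u + v) \<le> N u + N v)"

end

theory Submission
  imports Defs
begin

text \<open>
  Both radii are suprema over \<open>\<Pi>\<close> of seminorms, so each of them is a norm precisely when these
  seminorms separate the points of the space. For \<open>w\<^sub>p\<close> the triangle inequality of the single
  seminorms is Minkowski's inequality. The seminorms on \<open>L(X)\<^sup>k\<close> vanish on a tuple iff those
  on \<open>L(X)\<close> vanish on each of its components, so the two separation properties coincide;
  constant tuples give one direction.
\<close>

section \<open>Minkowski's inequality for finite sums\<close>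

lemma convex_on_powr_atLeast_0:
  fixes p :: real
  assumes "1 \<le> p"
  shows "convex_on {0..} (\<lambda>x. x powr p)"
proof (rule convex_onI)
  \<comment> \<open>When one of the two points is 0, convexity reduces to this inequality; it rests
    on \<open>c powr p \<le> c\<close> for 0 < c < 1. Two positive points are left to
    \<open>powr_convex\<close>.\<close>
  have scale: "(c * x) powr p \<le> c * x powr p" if "0 < c" "c < 1" "0 \<le> x" for c x :: real
  proof -
    have "c powr p \<le> c powr 1"
      using that assms by (intro powr_mono') auto
    then show ?thesis
      using that by (simp add: powr_mult mult_right_mono)
  qed
  fix t x y :: real
  assume t: "0 < t" "t < 1" and xy: "x \<in> {0..}" "y \<in> {0..}"
  then consider "x = 0" | "y = 0" | "0 < x" "0 < y" by fastforce
  then show "((1 - t) *\<^sub>R x + t *\<^sub>R y) powr p \<le> (1 - t) * x powr p + t * y powr p"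
  proof cases
    case 3
    then show ?thesis
      using convex_onD[OF powr_convex[OF assms], of t x y] t by simp
  qed (use t xy scale[of t y] scale[of "1 - t" x] in auto)
qed simp

text \<open>With weights proportional to \<open>A\<close> and \<open>B\<close>, the convex
  combination of the normalised terms \<open>a i / A\<close> and \<open>b i / B\<close> is
  \<open>(a i + b i) / (A + B)\<close>, so convexity of the power applies term by term. Normalising
  requires \<open>A\<close> and \<open>B\<close> to be positive; if one of them is 0, the
  corresponding family vanishes on \<open>I\<close>.\<close>

lemma Minkowski_sum_powr:
  fixes a b :: "'i \<Rightarrow> real"
  assumes "1 \<le> p" "finite I" and a: "\<And>i. i \<in> I \<Longrightarrow> 0 \<le> a i" and b: "\<And>i. i \<in> I \<Longrightarrow> 0 \<le> b i"
  shows "(\<Sum>i\<in>I. (a i + b i) powr p) powr (1 / p)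
    \<le> (\<Sum>i\<in>I. a i powr p) powr (1 / p) + (\<Sum>i\<in>I. b i powr p) powr (1 / p)"
proof -
  define A where "A = (\<Sum>i\<in>I. a i powr p) powr (1 / p)"
  define B where "B = (\<Sum>i\<in>I. b i powr p) powr (1 / p)"
  have A: "(\<Sum>i\<in>I. a i powr p) = A powr p" and B: "(\<Sum>i\<in>I. b i powr p) = B powr p"
    using \<open>1 \<le> p\<close> by (simp_all add: A_def B_def powr_powr sum_nonneg)
  have "0 \<le> A" "0 \<le> B"
    by (simp_all add: A_def B_def)
  have zero: "\<forall>i\<in>I. c i = 0" if "(\<Sum>i\<in>I. c i powr p) = 0" for c :: "'i \<Rightarrow> real"
    using that \<open>finite I\<close> by (simp add: sum_nonneg_eq_0_iff)
  consider "A = 0" | "B = 0" | "0 < A" "0 < B"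
    using \<open>0 \<le> A\<close> \<open>0 \<le> B\<close> by linarith
  then show ?thesis
  proof cases
    case 1
    then have "\<forall>i\<in>I. a i = 0"
      using zero[of a] A by simp
    then show ?thesis by simp
  next
    case 2
    then have "\<forall>i\<in>I. b i = 0"
      using zero[of b] B by simp
    then show ?thesis by simp
  next
    case 3
    define t where "t = B / (A + B)"
    have t: "0 \<le> t" "t \<le> 1" "1 - t = A / (A + B)"
      using 3 by (simp_all add: t_def field_simps)
    have weights: "(A + B) * ((1 - t) * (x / A) + t * (y / B)) = x + y" for x y
      using 3 unfolding t(3) by (simp add: t_def distrib_left)
    have *: "(a i + b i) powr p
        \<le> (A + B) powr p * ((1 - t) * (a i powr p / A powr p) + t * (b i powr p / B powr p))"
      if "i \<in> I" for i
    proof -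
      have "(a i + b i) powr p = ((A + B) * ((1 - t) * (a i / A) + t * (b i / B))) powr p"
        unfolding weights ..
      also have "\<dots> = (A + B) powr p * ((1 - t) * (a i / A) + t * (b i / B)) powr p"
        by (rule powr_mult)
      also have "((1 - t) * (a i / A) + t * (b i / B)) powr p
          \<le> (1 - t) * (a i / A) powr p + t * (b i / B) powr p"
        using convex_onD[OF convex_on_powr_atLeast_0[OF \<open>1 \<le> p\<close>], of t "a i / A" "b i / B"]
          t 3 a[OF that] b[OF that] by simp
      finally show ?thesis
        using 3 a[OF that] b[OF that] by (simp add: powr_divide mult_left_mono)
    qed
    have "(\<Sum>i\<in>I. (a i + b i) powr p)
        \<le> (\<Sum>i\<in>I. (A + B) powr p * ((1 - t) * (a i powr p / A powr p) + t * (b i powr p / B powr p)))"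
      by (intro sum_mono *)
    also have "\<dots> = (A + B) powr p
        * ((1 - t) * ((\<Sum>i\<in>I. a i powr p) / A powr p) + t * ((\<Sum>i\<in>I. b i powr p) / B powr p))"
      by (simp add: sum.distrib flip: sum_distrib_left sum_divide_distrib)
    \<comment> \<open>By the choice of \<open>A\<close> and \<open>B\<close> both quotients of sums
      equal 1, and the weights \<open>1 - t\<close> and \<open>t\<close> add up to 1.\<close>
    also have "\<dots> = (A + B) powr p"
      using 3 unfolding A B by simp
    finally have "(\<Sum>i\<in>I. (a i + b i) powr p) powr (1 / p) \<le> ((A + B) powr p) powr (1 / p)"
      using \<open>1 \<le> p\<close> by (intro powr_mono2) (auto intro: sum_nonneg)
    also have "\<dots> = A + B"
      using \<open>1 \<le> p\<close> 3 by (simp add: powr_powr)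
    finally show ?thesis by (simp add: A_def B_def)
  qed
qed

section \<open>Suprema of nonnegative reals, with value 0 on the empty set\<close>

lemma nonneg_Sup_upper: "bdd_above A \<Longrightarrow> x \<in> A \<Longrightarrow> x \<le> nonneg_Sup A"
  by (auto simp: nonneg_Sup_def intro: cSup_upper)

text \<open>The condition \<open>0 \<le> c\<close> takes care of the empty set.\<close>

lemma nonneg_Sup_least: "(\<And>x. x \<in> A \<Longrightarrow> x \<le> c) \<Longrightarrow> 0 \<le> c \<Longrightarrow> nonneg_Sup A \<le> c"
  by (auto simp: nonneg_Sup_def intro: cSup_least)

lemma nonneg_Sup_nonneg:
  assumes "bdd_above A" "\<And>x. x \<in> A \<Longrightarrow> 0 \<le> x"
  shows "0 \<le> nonneg_Sup A"
proof (cases "A = {}")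
  case False
  then obtain x where "x \<in> A" by blast
  then show ?thesis
    using assms(2)[of x] nonneg_Sup_upper[OF assms(1), of x] by linarith
qed (simp add: nonneg_Sup_def)

lemma nonneg_Sup_eq_0_iff:
  assumes "bdd_above A" "\<And>x. x \<in> A \<Longrightarrow> 0 \<le> x"
  shows "nonneg_Sup A = 0 \<longleftrightarrow> (\<forall>x\<in>A. x = 0)"
proof
  assume "nonneg_Sup A = 0"
  then show "\<forall>x\<in>A. x = 0"
    using assms nonneg_Sup_upper[OF assms(1)] by (metis order_antisym)
next
  assume "\<forall>x\<in>A. x = 0"
  then show "nonneg_Sup A = 0"
    using nonneg_Sup_least[of A 0] nonneg_Sup_nonneg[OF assms] by force
qed

lemma nonneg_Sup_mult:
  assumes "0 \<le> c" "bdd_above A" "\<And>x. x \<in> A \<Longrightarrow> 0 \<le> x"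
  shows "nonneg_Sup ((*) c ` A) = c * nonneg_Sup A"
proof (cases "c = 0")
  case True
  \<comment> \<open>The image is empty or {0}, and \<open>nonneg_Sup\<close> is 0 in both
    cases.\<close>
  then show ?thesis by (auto simp: nonneg_Sup_def image_constant_conv)
next
  case False
  have bdd: "bdd_above ((*) c ` A)"
    using assms(1,2) by (auto simp: bdd_above_def intro: mult_left_mono)
  show ?thesis
  proof (rule order_antisym)
    show "nonneg_Sup ((*) c ` A) \<le> c * nonneg_Sup A"
      using assms nonneg_Sup_nonneg[OF assms(2,3)]
      by (intro nonneg_Sup_least) (auto intro!: mult_left_mono nonneg_Sup_upper)
    \<comment> \<open>The reverse estimate divides by c, which is positive here.\<close>
    have "nonneg_Sup A \<le> nonneg_Sup ((*) c ` A) / c"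
    proof (rule nonneg_Sup_least)
      show "x \<le> nonneg_Sup ((*) c ` A) / c" if "x \<in> A" for x
        using nonneg_Sup_upper[OF bdd, of "c * x"] that False \<open>0 \<le> c\<close>
        by (simp add: field_simps)
      show "0 \<le> nonneg_Sup ((*) c ` A) / c"
        using nonneg_Sup_nonneg[OF bdd] assms by force
    qed
    then show "c * nonneg_Sup A \<le> nonneg_Sup ((*) c ` A)"
      using False \<open>0 \<le> c\<close> by (simp add: field_simps)
  qed
qed

text \<open>A pointwise bounded supremum of seminorms is again a seminorm, so only definiteness is
  left; a supremum of nonnegative values is 0 iff all of them are. Both radii are instances, with
  \<open>P\<close> the set \<open>Pi_set smul\<close>.\<close>

lemma is_norm_on_nonneg_Sup:
  assumes nonneg: "\<And>z u. z \<in> P \<Longrightarrow> u \<in> V \<Longrightarrow> 0 \<le> q z u"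
    and hom: "\<And>z c u. z \<in> P \<Longrightarrow> u \<in> V \<Longrightarrow> q z (smul c u) = norm c * q z u"
    and triangle: "\<And>z u v. z \<in> P \<Longrightarrow> u \<in> V \<Longrightarrow> v \<in> V \<Longrightarrow> q z (u + v) \<le> q z u + q z v"
    and bdd: "\<And>u. u \<in> V \<Longrightarrow> bdd_above ((\<lambda>z. q z u) ` P)"
  shows "is_norm_on smul V (\<lambda>u. nonneg_Sup ((\<lambda>z. q z u) ` P))
    \<longleftrightarrow> (\<forall>u\<in>V. (\<forall>z\<in>P. q z u = 0) \<longleftrightarrow> u = 0)"
proof -
  let ?N = "\<lambda>u. nonneg_Sup ((\<lambda>z. q z u) ` P)"
  have N_nonneg: "0 \<le> ?N u" if "u \<in> V" for u
    using that nonneg by (auto intro!: nonneg_Sup_nonneg bdd)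
  have N_zero: "?N u = 0 \<longleftrightarrow> (\<forall>z\<in>P. q z u = 0)" if "u \<in> V" for u
    using that nonneg by (subst nonneg_Sup_eq_0_iff) (auto intro!: bdd)
  have N_hom: "?N (smul c u) = norm c * ?N u" if "u \<in> V" for c u
  proof -
    have "(\<lambda>z. q z (smul c u)) ` P = (*) (norm c) ` (\<lambda>z. q z u) ` P"
      using that by (auto simp: hom image_image intro!: image_cong)
    then show ?thesis
      using that nonneg by (auto intro!: nonneg_Sup_mult bdd)
  qed
  have N_triangle: "?N (u + v) \<le> ?N u + ?N v" if "u \<in> V" "v \<in> V" for u v
  proof (rule nonneg_Sup_least)
    fix x assume "x \<in> (\<lambda>z. q z (u + v)) ` P"
    then obtain z where z: "z \<in> P" "x = q z (u + v)" by blast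
    have "q z u \<le> ?N u" "q z v \<le> ?N v"
      using z that by (auto intro!: nonneg_Sup_upper bdd)
    then show "x \<le> ?N u + ?N v"
      using triangle[of z u v] z that by linarith
  qed (simp add: N_nonneg that)
  show ?thesis
    unfolding is_norm_on_def using N_nonneg N_zero N_hom N_triangle by simp
qed

section \<open>The two radii as suprema of seminorms\<close>

context normed_space_over
begin

text \<open>Membership in \<open>Pi_set\<close> makes f linear over the whole scalar field, not only
  over the reals; homogeneity of the radii for complex c depends on this.\<close>

lemma Pi_set_apply_scale:
  "(x, f) \<in> Pi_set smul \<Longrightarrow> blinfun_apply f (smul c y) = c * blinfun_apply f y"
  by (auto simp: Pi_set_def bounded_operators_def linear_iff_module_hom module_hom.scale)

text \<open>This bound is uniform in (x, f), since both have norm 1, and so makes the suprema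
  finite.\<close>

lemma Pi_set_norm_le:
  assumes "(x, f) \<in> Pi_set smul"
  shows "norm (blinfun_apply f (blinfun_apply T x)) \<le> norm T"
proof -
  have "norm (blinfun_apply f (blinfun_apply T x)) \<le> norm f * norm (blinfun_apply T x)"
    by (rule norm_blinfun)
  also have "\<dots> \<le> norm T * norm x"
    using assms norm_blinfun[of T x] by (simp add: Pi_set_def)
  finally show ?thesis
    using assms by (simp add: Pi_set_def)
qed

lemma is_norm_on_numerical_radius_iff:
  "is_norm_on (scale_op smul) V (numerical_radius smul)
    \<longleftrightarrow> (\<forall>T\<in>V. (\<forall>(x, f)\<in>Pi_set smul. blinfun_apply f (blinfun_apply T x) = 0) \<longleftrightarrow> T = 0)"
proof -
  let ?q = "\<lambda>(x, f) T. norm (blinfun_apply f (blinfun_apply T x))"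
  have "numerical_radius smul = (\<lambda>T. nonneg_Sup ((\<lambda>z. ?q z T) ` Pi_set smul))"
    unfolding numerical_radius_def by (intro ext arg_cong[of _ _ nonneg_Sup]) force
  moreover have "is_norm_on (scale_op smul) V (\<lambda>T. nonneg_Sup ((\<lambda>z. ?q z T) ` Pi_set smul))
      \<longleftrightarrow> (\<forall>T\<in>V. (\<forall>z\<in>Pi_set smul. ?q z T = 0) \<longleftrightarrow> T = 0)"
  proof (rule is_norm_on_nonneg_Sup)
    show "bdd_above ((\<lambda>z. ?q z T) ` Pi_set smul)" for T
      by (rule bdd_aboveI[of _ "norm T"]) (auto intro: Pi_set_norm_le)
  qed (auto simp: scale_op_apply Pi_set_apply_scale norm_mult blinfun.add_left blinfun.add_right
      intro: norm_triangle_ineq)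
  ultimately show ?thesis
    by (simp add: case_prod_unfold)
qed

text \<open>For fixed (x, f) the seminorm is the p-norm of the vector of scalars f(T_i x). It
  vanishes iff every entry does, whence the inner quantifier over i.\<close>

lemma is_norm_on_joint_numerical_radius_iff:
  fixes V :: "(('a \<Rightarrow>\<^sub>L 'a) ^ 'n) set"
  assumes "1 \<le> p"
  shows "is_norm_on (scale_tuple smul) V (joint_numerical_radius smul p)
    \<longleftrightarrow> (\<forall>T\<in>V. (\<forall>(x, f)\<in>Pi_set smul. \<forall>i. blinfun_apply f (blinfun_apply (T $ i) x) = 0) \<longleftrightarrow> T = 0)"
proof -
  let ?q = "\<lambda>(x, f) (T :: ('a \<Rightarrow>\<^sub>L 'a) ^ 'n).
    (\<Sum>i\<in>UNIV. norm (blinfun_apply f (blinfun_apply (T $ i) x)) powr p) powr (1 / p)"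
  have "joint_numerical_radius smul p = (\<lambda>T. nonneg_Sup ((\<lambda>z. ?q z T) ` Pi_set smul))"
    unfolding joint_numerical_radius_def by (intro ext arg_cong[of _ _ nonneg_Sup]) force
  moreover have "is_norm_on (scale_tuple smul) V (\<lambda>T. nonneg_Sup ((\<lambda>z. ?q z T) ` Pi_set smul))
      \<longleftrightarrow> (\<forall>T\<in>V. (\<forall>z\<in>Pi_set smul. ?q z T = 0) \<longleftrightarrow> T = 0)"
  proof (rule is_norm_on_nonneg_Sup)
    fix z c T assume "z \<in> Pi_set smul"
    then obtain x f where z: "z = (x, f)" "(x, f) \<in> Pi_set smul" by (cases z) auto
    \<comment> \<open>The factor \<open>norm c powr p\<close> leaves the sum, and the outer exponent
      \<open>1 / p\<close> turns it back into \<open>norm c\<close>.\<close>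
    show "?q z (scale_tuple smul c T) = norm c * ?q z T"
      using \<open>1 \<le> p\<close> z by (simp add: scale_tuple_def scale_op_apply Pi_set_apply_scale norm_mult
        powr_mult sum_nonneg powr_powr flip: sum_distrib_left)
  next
    fix z T U assume "z \<in> Pi_set smul"
    then obtain x f where z: "z = (x, f)" by (cases z) auto
    \<comment> \<open>The triangle inequality for scalars and monotonicity of powers reduce the
      claim to Minkowski's inequality for the absolute values.\<close>
    have "?q z (T + U) \<le> (\<Sum>i\<in>UNIV. (norm (blinfun_apply f (blinfun_apply (T $ i) x))
        + norm (blinfun_apply f (blinfun_apply (U $ i) x))) powr p) powr (1 / p)"
      using \<open>1 \<le> p\<close> unfolding z
      by (auto simp: blinfun.add_left blinfun.add_right
          intro!: powr_mono2 sum_mono sum_nonneg norm_triangle_ineq)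
    also have "\<dots> \<le> ?q z T + ?q z U"
      unfolding z prod.case using \<open>1 \<le> p\<close> by (intro Minkowski_sum_powr) auto
    finally show "?q z (T + U) \<le> ?q z T + ?q z U" .
  next
    \<comment> \<open>The bound is the p-norm of the operator norms of the components.\<close>
    show "bdd_above ((\<lambda>z. ?q z T) ` Pi_set smul)" for T
      using \<open>1 \<le> p\<close> by (intro bdd_aboveI[of _ "(\<Sum>i\<in>UNIV. norm (T $ i) powr p) powr (1 / p)"])
        (auto intro!: powr_mono2 sum_mono sum_nonneg Pi_set_norm_le)
  qed auto
  ultimately show ?thesis
    by (simp add: case_prod_unfold sum_nonneg_eq_0_iff)
qed

lemma is_norm_on_joint_numerical_radius_iff_numerical_radius:
  assumes "1 \<le> p"
  shows "is_norm_on (scale_tuple smul) (L_tuples smul)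
        (joint_numerical_radius smul p :: ('a \<Rightarrow>\<^sub>L 'a) ^ 'n \<Rightarrow> real)
      \<longleftrightarrow> is_norm_on (scale_op smul) (L_space smul) (numerical_radius smul)"
  unfolding is_norm_on_joint_numerical_radius_iff[OF assms] is_norm_on_numerical_radius_iff
proof
  assume *: "\<forall>T\<in>L_tuples smul :: (('a \<Rightarrow>\<^sub>L 'a) ^ 'n) set.
    (\<forall>(x, f)\<in>Pi_set smul. \<forall>i. blinfun_apply f (blinfun_apply (T $ i) x) = 0) \<longleftrightarrow> T = 0"
  show "\<forall>T\<in>L_space smul.
    (\<forall>(x, f)\<in>Pi_set smul. blinfun_apply f (blinfun_apply T x) = 0) \<longleftrightarrow> T = 0"
  proof
    fix T assume "T \<in> L_space smul"
    \<comment> \<open>The index type is nonempty, so the constant tuple is 0 only if T is 0; thus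
      separation on tuples passes to T.\<close>
    then have "(\<chi> i. T) \<in> (L_tuples smul :: (('a \<Rightarrow>\<^sub>L 'a) ^ 'n) set)"
      by (simp add: L_tuples_def)
    from *[rule_format, OF this]
    show "(\<forall>(x, f)\<in>Pi_set smul. blinfun_apply f (blinfun_apply T x) = 0) \<longleftrightarrow> T = 0"
      by (simp add: vec_eq_iff)
  qed
next
  assume "\<forall>T\<in>L_space smul.
    (\<forall>(x, f)\<in>Pi_set smul. blinfun_apply f (blinfun_apply T x) = 0) \<longleftrightarrow> T = 0"
  then show "\<forall>T\<in>L_tuples smul :: (('a \<Rightarrow>\<^sub>L 'a) ^ 'n) set.
    (\<forall>(x, f)\<in>Pi_set smul. \<forall>i. blinfun_apply f (blinfun_apply (T $ i) x) = 0) \<longleftrightarrow> T = 0"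
    \<comment> \<open>The quantifiers over (x, f) and i commute, so the assumption can be applied to
      each component \<open>T $ i\<close> separately.\<close>
    unfolding L_tuples_def vec_eq_iff by fastforce
qed

end

theorem proposition2p4:
  fixes p :: real
    and scaleC :: "complex \<Rightarrow> 'b::banach \<Rightarrow> 'b"
  assumes "1 \<le> p"
  shows "(is_norm_on (scale_tuple (scaleR :: real \<Rightarrow> 'a::banach \<Rightarrow> 'a)) (L_tuples scaleR)
            (joint_numerical_radius scaleR p :: ('a \<Rightarrow>\<^sub>L 'a) ^ 'n \<Rightarrow> real)
          \<longleftrightarrow> is_norm_on (scale_op (scaleR :: real \<Rightarrow> 'a \<Rightarrow> 'a)) (L_space scaleR)
            (numerical_radius scaleR))
       \<and> (normed_space_over scaleC \<longrightarrow>
          (is_norm_on (scale_tuple scaleC) (L_tuples scaleC)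
            (joint_numerical_radius scaleC p :: ('b \<Rightarrow>\<^sub>L 'b) ^ 'n \<Rightarrow> real)
          \<longleftrightarrow> is_norm_on (scale_op scaleC) (L_space scaleC) (numerical_radius scaleC)))"
  \<comment> \<open>Both conjuncts are the same result for an arbitrary scalar field:
    \<open>normed_space_over_scaleR\<close> supplies the real structure, and the premise on
    \<open>scaleC\<close> the complex one.\<close>
  by (intro conjI impI normed_space_over_scaleR
    normed_space_over.is_norm_on_joint_numerical_radius_iff_numerical_radius[OF _ assms])

end
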